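(* Let $f\in\mathbb N\setminus\{0\}$. Then $$\operatorname{Sat}(f)\subseteq\operatorname{Arf}(f)\subseteq\mathcal A(f)$$ is a chain of covarieties such that $\Delta(f)=\min_\subseteq(\operatorname{Sat}(f))=\min_\subseteq(\operatorname{Arf}(f))=\min_\subseteq(\mathcal A(f))$, where $\Delta(f)=\{0,f+1,f+2,\dots\}$.
   Context: $\mathbb N=\{0,1,2,\dots\}$. A numerical semigroup is a submonoid $S$ of $(\mathbb N,+)$ with finite complement; $\operatorname{Fb}(S)=\max(\mathbb N\setminus S)$ is its Frobenius number ($-1$ if $S=\mathbb N$) and $\operatorname{m}(S)=\min(S\setminus\{0\})$ its multiplicity. $S$ is an $\mathcal A$-semigroup if there is no $s$ with $s,s+1\in S$ and $s,s+1<\operatorname{Fb}(S)$; $\mathcal A(f)$ is the set of numerical $\mathcal A$-semigroups with Frobenius number $f$. $S$ is an Arf semigroup if $x+y-z\in S$ for all $x,y,z\in S$ with $x\ge y\ge z$; $\operatorname{Arf}(f)$ is the set of Arf numerical semigroups with Frobenius number $f$. $S$ is saturated if for all $s,s_1,\dots,s_r\in S$ with $s_i\le s$ for all $i$ and all $z_1,\dots,z_r\in\mathbb Z$ with $z_1s_1+\cdots+z_rs_r\ge0$, one has $s+z_1s_1+\cdots+z_rs_r\in S$; $\operatorname{Sat}(f)$ is the set of saturated numerical semigroups with Frobenius number $f$. A covariety (of numerical semigroups) is a non-empty family $V$ of numerical semigroups such that: (i) $V$ has a minimum element with respect to inclusion, denoted $\min_\subseteq V$; (ii) if $S,T\in V$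 then $S\cap T\in V$; (iii) if $S\in V\setminus\{\min_\subseteq V\}$ then $S\setminus\{\operatorname{m}(S)\}\in V$. *)

theory Defs
  imports Main
begin

definition numerical_semigroup :: "nat set \<Rightarrow> bool" where
  "numerical_semigroup S \<longleftrightarrow>
     0 \<in> S \<and> (\<forall>x\<in>S. \<forall>y\<in>S. x + y \<in> S) \<and> finite (UNIV - S)"

definition Fb :: "nat set \<Rightarrow> int" where
  "Fb S = (if S = UNIV then -1 else int (Max (UNIV - S)))"

definition multiplicity_of :: "nat set \<Rightarrow> nat" where
  "multiplicity_of S = (LEAST s. s \<in> S - {0})"

definition A_semigroup :: "nat set \<Rightarrow> bool" where
  "A_semigroup S \<longleftrightarrow> numerical_semigroup S \<and>
     \<not> (\<exists>s. s \<in> S \<and> s + 1 \<in> S \<and> int s < Fb S \<and> int (s + 1) < Fb S)"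

(* The subtraction on nat below never truncates, since z \<le> y. *)
definition Arf_semigroup :: "nat set \<Rightarrow> bool" where
  "Arf_semigroup S \<longleftrightarrow> numerical_semigroup S \<and>
     (\<forall>x\<in>S. \<forall>y\<in>S. \<forall>z\<in>S. x \<ge> y \<and> y \<ge> z \<longrightarrow> x + y - z \<in> S)"

(* The finite families of elements and of integer coefficients are functions
   of which only the values at 1, ..., r matter. *)
definition saturated_semigroup :: "nat set \<Rightarrow> bool" where
  "saturated_semigroup S \<longleftrightarrow> numerical_semigroup S \<and>
     (\<forall>s\<in>S. \<forall>(r::nat) (t :: nat \<Rightarrow> nat) (z :: nat \<Rightarrow> int).
        (\<forall>i\<in>{1..r}. t i \<in> S \<and> t i \<le> s) \<longrightarrow>
        0 \<le> (\<Sum>i=1..r. z i * int (t i)) \<longrightarrow>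
        int s + (\<Sum>i=1..r. z i * int (t i)) \<in> int ` S)"

definition A_family :: "nat \<Rightarrow> nat set set" where
  "A_family f = {S. A_semigroup S \<and> Fb S = int f}"

definition Arf :: "nat \<Rightarrow> nat set set" where
  "Arf f = {S. Arf_semigroup S \<and> Fb S = int f}"

definition Sat :: "nat \<Rightarrow> nat set set" where
  "Sat f = {S. saturated_semigroup S \<and> Fb S = int f}"

definition Delta :: "nat \<Rightarrow> nat set" where
  "Delta f = {0} \<union> {f + 1..}"

(* The order on nat set is inclusion, so this is the minimum element of V
   (unspecified if V has none). *)
definition min_incl :: "nat set set \<Rightarrow> nat set" where
  "min_incl V = (LEAST S. S \<in> V)"

lemma min_incl_eqI:
  assumes "M \<in> V" "\<And>S. S \<in> V \<Longrightarrow> M \<subseteq> S"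
  shows "min_incl V = M"
  unfolding min_incl_def using assms by (intro Least_equality) auto

definition covariety :: "nat set set \<Rightarrow> bool" where
  "covariety V \<longleftrightarrow>
     V \<noteq> {} \<and> (\<forall>S\<in>V. numerical_semigroup S) \<and>
     (\<exists>M\<in>V. \<forall>S\<in>V. M \<subseteq> S) \<and>
     (\<forall>S\<in>V. \<forall>T\<in>V. S \<inter> T \<in> V) \<and>
     (\<forall>S\<in>V - {min_incl V}. S - {multiplicity_of S} \<in> V)"

end

theory Submission
  imports Defs
begin

text \<open>
  All three families consist of numerical semigroups with one and the same Frobenius number \<open>f\<close>.
  Such a semigroup contains \<open>0\<close> and every number above \<open>f\<close>, hence it contains \<open>\<Delta>(f)\<close>, and
  \<open>\<Delta>(f)\<close> itself lies in each family. So \<open>\<Delta>(f)\<close> is the common minimum, and what has to be shown is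
  that each of the defining conditions survives intersections and the removal of the multiplicity
  \<open>m\<close> of a semigroup other than \<open>\<Delta>(f)\<close>.

  Intersections are harmless because the conditions are closure conditions (Arf, saturated) or pass
  to subsets with the same Frobenius number (the \<open>\<A>\<close>-condition). Removing \<open>m\<close> keeps the Frobenius
  number, since \<open>m < f\<close>. It also keeps a closure condition as soon as every number that the condition
  produces is at least as large as some input \<open>x\<close>, and is \<open>0\<close> if that \<open>x\<close> is \<open>0\<close>: if \<open>m\<close>
  were produced, then \<open>x \<le> m\<close> and \<open>x \<noteq> m\<close> would leave only \<open>x = 0\<close>, which produces \<open>0 \<noteq> m\<close>. For the
  Arf condition \<open>x + y - z\<close> take the largest element \<open>x\<close>; for saturation take \<open>s\<close>.

  As for the inclusions, the Arf condition is saturation for the single combination \<open>y - z\<close>. In an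
  Arf semigroup two consecutive elements \<open>s\<close>, \<open>s + 1\<close> yield \<open>s + 2 = (s + 1) + (s + 1) - s\<close>, thus
  all larger numbers, which is impossible below the Frobenius number.
\<close>

section \<open>Frobenius number, multiplicity and the minimum\<close>

text \<open>
  This form turns the Frobenius number into membership conditions, which behave well under
  intersection and removal of elements, so that the maximum never has to be computed again.
\<close>

lemma Fb_eq_int_iff:
  assumes "numerical_semigroup S"
  shows "Fb S = int f \<longleftrightarrow> f \<notin> S \<and> {f + 1..} \<subseteq> S"
proof -
  have fin: "finite (UNIV - S)"
    using assms by (simp add: numerical_semigroup_def)
  show ?thesis
  proof
    assume Fb: "Fb S = int f"
    hence ne: "S \<noteq> UNIV" and f: "f = Max (UNIV - S)"
      by (auto simp: Fb_def split: if_splits)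
    have "f \<notin> S"
      using Max_in[OF fin] ne f by auto
    moreover have "x \<in> S" if "f + 1 \<le> x" for x
      using Max_ge[OF fin, of x] that f by auto
    ultimately show "f \<notin> S \<and> {f + 1..} \<subseteq> S"
      by auto
  next
    assume gap: "f \<notin> S \<and> {f + 1..} \<subseteq> S"
    have "x \<le> f" if "x \<notin> S" for x
      using gap that by (metis atLeast_iff not_less_eq_eq Suc_eq_plus1 subsetD)
    hence "Max (UNIV - S) = f"
      using gap by (intro Max_eqI fin) auto
    thus "Fb S = int f"
      using gap by (auto simp: Fb_def)
  qed
qed

lemma numerical_semigroup_Delta: "numerical_semigroup (Delta f)"
proof -
  have "UNIV - Delta f \<subseteq> {..f}"
    by (auto simp: Delta_def)
  thus ?thesis
    by (auto simp: numerical_semigroup_def Delta_def intro: finite_subset)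
qed

text \<open>For \<open>f = 0\<close> this would fail: \<open>\<Delta>(0) = \<nat>\<close> has Frobenius number \<open>-1\<close>.\<close>

lemma Fb_Delta: "f \<noteq> 0 \<Longrightarrow> Fb (Delta f) = int f"
  by (subst Fb_eq_int_iff[OF numerical_semigroup_Delta]) (auto simp: Delta_def)

lemma Delta_subset:
  assumes "numerical_semigroup S" "Fb S = int f"
  shows "Delta f \<subseteq> S"
  using assms Fb_eq_int_iff[OF assms(1)] by (auto simp: Delta_def numerical_semigroup_def)

lemma numerical_semigroup_Int:
  assumes "numerical_semigroup S" "numerical_semigroup T"
  shows "numerical_semigroup (S \<inter> T)"
  using assms by (auto simp: numerical_semigroup_def Diff_Int)

lemma Fb_Int:
  assumes "numerical_semigroup S" "Fb S = int f" "numerical_semigroup T" "Fb T = int f"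
  shows "Fb (S \<inter> T) = int f"
  using assms by (simp add: Fb_eq_int_iff numerical_semigroup_Int)

text \<open>
  A semigroup other than \<open>\<Delta>(f)\<close> has a nonzero element below \<open>f\<close>, and the multiplicity is at most that
  element. Without this exception the multiplicity would be \<open>f + 1\<close>, whose removal changes the
  Frobenius number.
\<close>

lemma multiplicity_of_less_Frobenius:
  assumes S: "numerical_semigroup S" and Fb: "Fb S = int f" and ne: "S \<noteq> Delta f"
  shows "multiplicity_of S \<in> S" "0 < multiplicity_of S" "multiplicity_of S < f"
    and "\<And>x. x \<in> S \<Longrightarrow> x < multiplicity_of S \<Longrightarrow> x = 0"
proof -
  have gap: "f \<notin> S"
    using Fb Fb_eq_int_iff[OF S] by auto
  obtain a where a: "a \<in> S" "a \<notin> Delta f"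
    using Delta_subset[OF S Fb] ne by auto
  hence "a \<noteq> 0" "a \<le> f"
    by (auto simp: Delta_def)
  hence "a < f"
    using a gap by (cases "a = f") auto
  have m: "multiplicity_of S \<in> S - {0}"
    unfolding multiplicity_of_def by (rule LeastI[of _ a]) (use a \<open>a \<noteq> 0\<close> in auto)
  have le: "multiplicity_of S \<le> x" if "x \<in> S - {0}" for x
    unfolding multiplicity_of_def using that by (rule Least_le)
  show "multiplicity_of S \<in> S" "0 < multiplicity_of S"
    using m by auto
  show "multiplicity_of S < f"
    using le[of a] a \<open>a \<noteq> 0\<close> \<open>a < f\<close> by auto
  show "x = 0" if "x \<in> S" "x < multiplicity_of S" for x
    using le[of x] that by auto
qed

text \<open>The multiplicity is not a sum of two nonzero elements, and it lies below \<open>f\<close>.\<close>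

lemma remove_multiplicity:
  assumes S: "numerical_semigroup S" and Fb: "Fb S = int f" and ne: "S \<noteq> Delta f"
  shows "numerical_semigroup (S - {multiplicity_of S})"
    and "Fb (S - {multiplicity_of S}) = int f"
proof -
  let ?m = "multiplicity_of S"
  note m = multiplicity_of_less_Frobenius[OF S Fb ne]
  have "x + y \<noteq> ?m" if "x \<in> S - {?m}" "y \<in> S - {?m}" for x y
  proof
    assume sum: "x + y = ?m"
    with that have "x < ?m" "y < ?m"
      by auto
    hence "x = 0" "y = 0"
      using that m(4) by auto
    thus False
      using sum m(2) by simp
  qed
  moreover have "UNIV - (S - {?m}) = insert ?m (UNIV - S)"
    by auto
  ultimately show *: "numerical_semigroup (S - {?m})"
    using S m(2) by (auto simp: numerical_semigroup_def)
  show "Fb (S - {?m}) = int f"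
    using Fb m(3) by (auto simp: Fb_eq_int_iff S *)
qed

text \<open>
  The shared skeleton of the three covariety proofs: membership of \<open>\<Delta>(f)\<close> already
  makes it the minimum, so the pruning condition only concerns semigroups other than \<open>\<Delta>(f)\<close>.
\<close>

lemma covariety_of_fixed_Frobenius:
  assumes sg: "\<And>S. S \<in> V \<Longrightarrow> numerical_semigroup S \<and> Fb S = int f"
    and Delta: "Delta f \<in> V"
    and Int: "\<And>S T. S \<in> V \<Longrightarrow> T \<in> V \<Longrightarrow> S \<inter> T \<in> V"
    and remove: "\<And>S. S \<in> V \<Longrightarrow> S \<noteq> Delta f \<Longrightarrow> S - {multiplicity_of S} \<in> V"
  shows "covariety V" and "min_incl V = Delta f"
proof -
  have least: "Delta f \<subseteq> S" if "S \<in> V" for S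
    using sg[OF that] Delta_subset by blast
  show min: "min_incl V = Delta f"
    using Delta least by (rule min_incl_eqI)
  show "covariety V"
    unfolding covariety_def min
  proof (intro conjI ballI)
    show "V \<noteq> {}" "\<exists>M\<in>V. \<forall>S\<in>V. M \<subseteq> S"
      using Delta least by auto
  qed (use sg Int remove in auto)
qed

section \<open>\<open>\<A>\<close>-semigroups\<close>

lemma A_semigroup_subset:
  assumes "A_semigroup S" "T \<subseteq> S" "numerical_semigroup T" "Fb T = Fb S"
  shows "A_semigroup T"
  using assms by (auto simp: A_semigroup_def)

lemma A_family_covariety:
  assumes "f \<noteq> 0"
  shows "covariety (A_family f)" and "min_incl (A_family f) = Delta f"
proof -
  have sg: "numerical_semigroup S \<and> Fb S = int f" if "S \<in> A_family f" for S
    using that by (simp add: A_family_def A_semigroup_def)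
  have sub: "T \<in> A_family f"
    if "S \<in> A_family f" "T \<subseteq> S" "numerical_semigroup T" "Fb T = int f" for S T
    using that A_semigroup_subset[of S T] by (auto simp: A_family_def)
  have Delta: "Delta f \<in> A_family f"
    using assms numerical_semigroup_Delta Fb_Delta
    by (auto simp: A_family_def A_semigroup_def Delta_def)
  have Int: "S \<inter> T \<in> A_family f" if "S \<in> A_family f" "T \<in> A_family f" for S T
    by (rule sub[of S])
      (use that sg[OF that(1)] sg[OF that(2)] numerical_semigroup_Int Fb_Int in auto)
  have remove: "S - {multiplicity_of S} \<in> A_family f" if "S \<in> A_family f" "S \<noteq> Delta f" for S
    by (rule sub[of S]) (use that sg[OF that(1)] remove_multiplicity[of S f] in auto)
  show "covariety (A_family f)"
    by (rule covariety_of_fixed_Frobenius(1)[of "A_family f" f]) (fact sg Delta Int remove)+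
  show "min_incl (A_family f) = Delta f"
    by (rule covariety_of_fixed_Frobenius(2)[of "A_family f" f]) (fact sg Delta Int remove)+
qed

section \<open>Arf semigroups\<close>

text \<open>Each consecutive pair \<open>a\<close>, \<open>a + 1\<close> produces \<open>a + 2 = (a + 1) + (a + 1) - a\<close>, hence the next pair.\<close>

lemma Arf_consecutive_imp_all_ge:
  assumes "Arf_semigroup S" "s \<in> S" "s + 1 \<in> S"
  shows "s + k \<in> S \<and> s + k + 1 \<in> S"
proof (induction k)
  case 0
  thus ?case using assms by simp
next
  case (Suc k)
  hence "(s + k + 1) + (s + k + 1) - (s + k) \<in> S"
    using assms(1) unfolding Arf_semigroup_def by (metis le_add1 order_refl)
  thus ?case
    using Suc by simp
qed

lemma Arf_subset_A_family: "Arf f \<subseteq> A_family f"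
proof
  fix S assume "S \<in> Arf f"
  hence arf: "Arf_semigroup S" and S: "numerical_semigroup S" and Fb: "Fb S = int f"
    by (auto simp: Arf_def Arf_semigroup_def)
  have False if "s \<in> S" "s + 1 \<in> S" "s < f" for s
    using Arf_consecutive_imp_all_ge[OF arf that(1,2), of "f - s"] that(3) Fb
    by (simp add: Fb_eq_int_iff S)
  thus "S \<in> A_family f"
    using S Fb by (auto simp: A_family_def A_semigroup_def)
qed

lemma Arf_covariety:
  assumes "f \<noteq> 0"
  shows "covariety (Arf f)" and "min_incl (Arf f) = Delta f"
proof -
  have sg: "numerical_semigroup S \<and> Fb S = int f" if "S \<in> Arf f" for S
    using that by (simp add: Arf_def Arf_semigroup_def)
  have Delta: "Delta f \<in> Arf f"
    using assms numerical_semigroup_Delta Fb_Delta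
    by (auto simp: Arf_def Arf_semigroup_def Delta_def)
  have Int: "S \<inter> T \<in> Arf f" if "S \<in> Arf f" "T \<in> Arf f" for S T
    using that numerical_semigroup_Int Fb_Int by (simp add: Arf_def Arf_semigroup_def)
  have remove: "S - {multiplicity_of S} \<in> Arf f" if "S \<in> Arf f" and ne: "S \<noteq> Delta f" for S
  proof -
    let ?m = "multiplicity_of S"
    have S: "numerical_semigroup S" and Fb: "Fb S = int f" and arf: "Arf_semigroup S"
      using that(1) by (auto simp: Arf_def Arf_semigroup_def)
    note m = multiplicity_of_less_Frobenius[OF S Fb ne]
    have "x + y - z \<in> S - {?m}"
      if xyz: "x \<in> S - {?m}" "y \<in> S" "z \<in> S" "x \<ge> y" "y \<ge> z" for x y z
    proof -
      \<comment> \<open>As \<open>x + y - z \<ge> x\<close>, the value \<open>?m\<close> would force \<open>x = 0\<close> and with it \<open>y = z = 0\<close>.\<close>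
      have "x + y - z \<noteq> ?m"
      proof
        assume eq: "x + y - z = ?m"
        with xyz have "x < ?m"
          by auto
        hence "x = 0"
          using xyz m(4) by auto
        thus False
          using eq xyz m(2) by simp
      qed
      moreover have "x + y - z \<in> S"
        using arf xyz unfolding Arf_semigroup_def by blast
      ultimately show ?thesis
        by simp
    qed
    thus ?thesis
      using remove_multiplicity[OF S Fb ne] by (simp add: Arf_def Arf_semigroup_def)
  qed
  show "covariety (Arf f)"
    by (rule covariety_of_fixed_Frobenius(1)[of "Arf f" f]) (fact sg Delta Int remove)+
  show "min_incl (Arf f) = Delta f"
    by (rule covariety_of_fixed_Frobenius(2)[of "Arf f" f]) (fact sg Delta Int remove)+
qed

section \<open>Saturated semigroups\<close>

lemma saturatedD:
  fixes r :: nat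
  assumes "saturated_semigroup S" "s \<in> S" "\<And>i. i \<in> {1..r} \<Longrightarrow> t i \<in> S \<and> t i \<le> s"
    and "0 \<le> (\<Sum>i=1..r. z i * int (t i))"
  shows "int s + (\<Sum>i=1..r. z i * int (t i)) \<in> int ` S"
  using assms unfolding saturated_semigroup_def by blast

lemma Sat_subset_Arf: "Sat f \<subseteq> Arf f"
proof
  fix S assume "S \<in> Sat f"
  hence sat: "saturated_semigroup S" and S: "numerical_semigroup S" and Fb: "Fb S = int f"
    by (auto simp: Sat_def saturated_semigroup_def)
  have "x + y - z \<in> S" if "x \<in> S" "y \<in> S" "z \<in> S" "x \<ge> y" "y \<ge> z" for x y z
  proof -
    \<comment> \<open>Saturation at \<open>x\<close> with the two elements \<open>y\<close>, \<open>z\<close> and the coefficients \<open>1\<close>, \<open>-1\<close>.\<close>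
    define t where "t = (\<lambda>i::nat. if i = 1 then y else z)"
    define c where "c = (\<lambda>i::nat. if i = 1 then 1 else - 1 :: int)"
    have sum: "(\<Sum>i=1..2. c i * int (t i)) = int y - int z"
      by (simp add: numeral_2_eq_2 t_def c_def)
    have t: "t i \<in> S \<and> t i \<le> x" for i
      using that by (auto simp: t_def)
    have "int x + (\<Sum>i=1..2. c i * int (t i)) \<in> int ` S"
      by (rule saturatedD[OF sat that(1) t]) (use sum that in simp)
    hence "int (x + y - z) \<in> int ` S"
      unfolding sum using that by (simp add: of_nat_diff algebra_simps)
    thus ?thesis
      by auto
  qed
  thus "S \<in> Arf f"
    using S Fb by (simp add: Arf_def Arf_semigroup_def)
qed

lemma sum_combination_eq_0:
  fixes r :: nat
  assumes "\<And>i. i \<in> {1..r} \<Longrightarrow> t i \<le> (0::nat)"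
  shows "(\<Sum>i=1..r. z i * int (t i)) = 0"
  using assms by (intro sum.neutral) auto

text \<open>
  Saturation at \<open>s = 0\<close> only admits the zero combination; a nonzero \<open>s\<close> already exceeds \<open>f\<close>, and
  adding a nonnegative number keeps it there.
\<close>

lemma saturated_Delta: "saturated_semigroup (Delta f)"
  unfolding saturated_semigroup_def
proof (intro conjI ballI allI impI numerical_semigroup_Delta)
  fix s r :: nat and t :: "nat \<Rightarrow> nat" and z :: "nat \<Rightarrow> int"
  let ?c = "\<Sum>i=1..r. z i * int (t i)"
  assume s: "s \<in> Delta f" and t: "\<forall>i\<in>{1..r}. t i \<in> Delta f \<and> t i \<le> s" and c: "0 \<le> ?c"
  have "s + nat ?c \<in> Delta f"
  proof (cases "s = 0")
    case True
    thus ?thesis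
      using s t sum_combination_eq_0[of r t z] by simp
  next
    case False
    thus ?thesis
      using s by (auto simp: Delta_def)
  qed
  thus "int s + ?c \<in> int ` Delta f"
    using c by (intro image_eqI[of _ _ "s + nat ?c"]) auto
qed

lemma saturated_Int:
  assumes "saturated_semigroup S" "saturated_semigroup T"
  shows "saturated_semigroup (S \<inter> T)"
  unfolding saturated_semigroup_def
proof (intro conjI ballI allI impI)
  show "numerical_semigroup (S \<inter> T)"
    using assms numerical_semigroup_Int by (simp add: saturated_semigroup_def)
next
  fix s r :: nat and t :: "nat \<Rightarrow> nat" and z :: "nat \<Rightarrow> int"
  let ?c = "\<Sum>i=1..r. z i * int (t i)"
  assume H: "s \<in> S \<inter> T" "\<forall>i\<in>{1..r}. t i \<in> S \<inter> T \<and> t i \<le> s" "0 \<le> ?c"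
  have "int s + ?c \<in> int ` S"
    using H by (intro saturatedD[OF assms(1)]) auto
  moreover have "int s + ?c \<in> int ` T"
    using H by (intro saturatedD[OF assms(2)]) auto
  ultimately show "int s + ?c \<in> int ` (S \<inter> T)"
    by (auto simp: image_Int)
qed

text \<open>
  Since the combination is nonnegative, the multiplicity can only be produced from an \<open>s\<close> below
  it, that is from \<open>s = 0\<close>; but then all \<open>t i\<close> vanish as well and only \<open>0\<close> is produced.
\<close>

lemma saturated_remove_multiplicity:
  assumes sat: "saturated_semigroup S" and Fb: "Fb S = int f" and ne: "S \<noteq> Delta f"
  shows "saturated_semigroup (S - {multiplicity_of S})"
  unfolding saturated_semigroup_def
proof (intro conjI ballI allI impI)
  let ?m = "multiplicity_of S"
  have S: "numerical_semigroup S"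
    using sat by (simp add: saturated_semigroup_def)
  note m = multiplicity_of_less_Frobenius[OF S Fb ne]
  show "numerical_semigroup (S - {?m})"
    using remove_multiplicity(1)[OF S Fb ne] .
  fix s r :: nat and t :: "nat \<Rightarrow> nat" and z :: "nat \<Rightarrow> int"
  let ?c = "\<Sum>i=1..r. z i * int (t i)"
  assume s: "s \<in> S - {?m}" and t: "\<forall>i\<in>{1..r}. t i \<in> S - {?m} \<and> t i \<le> s" and c: "0 \<le> ?c"
  have "int s + ?c \<in> int ` S"
    using s t c by (intro saturatedD[OF sat]) auto
  moreover have "int s + ?c \<noteq> int ?m"
  proof
    assume eq: "int s + ?c = int ?m"
    with s c have "s < ?m"
      by (cases "s = ?m") auto
    hence "s = 0"
      using s m(4) by auto
    thus False
      using eq t m(2) sum_combination_eq_0[of r t z] by simp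
  qed
  ultimately show "int s + ?c \<in> int ` (S - {?m})"
    by auto
qed

lemma Sat_covariety:
  assumes "f \<noteq> 0"
  shows "covariety (Sat f)" and "min_incl (Sat f) = Delta f"
proof -
  have sg: "numerical_semigroup S \<and> Fb S = int f" if "S \<in> Sat f" for S
    using that by (simp add: Sat_def saturated_semigroup_def)
  have Delta: "Delta f \<in> Sat f"
    using assms saturated_Delta Fb_Delta by (simp add: Sat_def)
  have Int: "S \<inter> T \<in> Sat f" if "S \<in> Sat f" "T \<in> Sat f" for S T
    using that sg[OF that(1)] sg[OF that(2)] Fb_Int saturated_Int by (simp add: Sat_def)
  have remove: "S - {multiplicity_of S} \<in> Sat f" if "S \<in> Sat f" "S \<noteq> Delta f" for S
    using that sg[OF that(1)] remove_multiplicity(2)[of S f] saturated_remove_multiplicity[of S f]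
    by (simp add: Sat_def)
  show "covariety (Sat f)"
    by (rule covariety_of_fixed_Frobenius(1)[of "Sat f" f]) (fact sg Delta Int remove)+
  show "min_incl (Sat f) = Delta f"
    by (rule covariety_of_fixed_Frobenius(2)[of "Sat f" f]) (fact sg Delta Int remove)+
qed

theorem proposition47:
  fixes f :: nat
  assumes "f \<noteq> 0"
  shows "Sat f \<subseteq> Arf f \<and> Arf f \<subseteq> A_family f \<and>
         covariety (Sat f) \<and> covariety (Arf f) \<and> covariety (A_family f) \<and>
         Delta f = min_incl (Sat f) \<and>
         min_incl (Sat f) = min_incl (Arf f) \<and>
         min_incl (Arf f) = min_incl (A_family f)"
  using Sat_subset_Arf Arf_subset_A_family
    Sat_covariety[OF assms] Arf_covariety[OF assms] A_family_covariety[OF assms] by simp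

end
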